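(* Let $d\ge 1$ and, for $i\in\{1,\dots,d\}$, let $(X_i,\mu_i,T_i)$ be a dynamical system on a probability space with $T_i$-invariant probability measure $\mu_i$. Suppose that for each $i$ there exist: (1) a collection $\mathcal A_i$ of measurable subsets of $X_i$ such that for every measurable $B\subset X_i$ and every $\epsilon>0$ there is a sequence of pairwise disjoint sets $A_j\in\mathcal A_i$ with $\mu_i\left(B\,\Delta\,\bigsqcup_j A_j\right)<\epsilon$; (2) a function $n_i:\mathcal A_i\to\mathbb N$ such that $\mu_i\left(T_i^{n_i(A)}A\right)=1$ for every $A\in\mathcal A_i$; (3) a constant $\lambda_i>0$ such that for every $A\in\mathcal A_i$ and every measurable $B\subset A$ one has $\mu_i\left(T_i^{n_i(A)}B\right)\le\lambda_i\,\frac{\mu_i(B)}{\mu_i(A)}$. Then the product system $(X,\mu,T)=(X_1\times\cdots\times X_d,\ \mu_1\times\cdots\times\mu_d,\ T_1\times\cdots\times T_d)$ is exact.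
   Context: A dynamical system $(X,\mu,T)$ is a measurable map $T:X\to X$ (possibly defined only away from a set of measure zero) on a measure space $(X,\Sigma,\mu)$, where $\mu$ is a $T$-invariant probability measure. The product system carries the product $\sigma$-algebra, the product measure, and the map $(T_1\times\cdots\times T_d)(x_1,\dots,x_d)=(T_1(x_1),\dots,T_d(x_d))$. A system $(X,\mu,T)$ is exact if $\mu(A)>0$ implies $\lim_{n\to\infty}\mu(T^nA)=1$; equivalently, $\bigcap_{n>0}T^{-n}\mathcal M=\mathcal N$, where $\mathcal M$ is the $\sigma$-algebra of measurable sets and $\mathcal N$ is the $\sigma$-algebra of null and co-null sets. Whenever $\mu$ is applied to a forward image of a measurable set, that image is understood to be measurable; the tail $\sigma$-algebra formulation does not refer to forward images. *)

theory Defs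
  imports "HOL-Probability.Probability"
begin

text \<open>
  A self-map that may be undefined on a null set is represented by a domain \<open>D\<close> of full measure
  together with a total function \<open>T\<close> whose values outside \<open>D\<close> are never used.
\<close>

definition dynamical_system :: "'a measure \<Rightarrow> 'a set \<Rightarrow> ('a \<Rightarrow> 'a) \<Rightarrow> bool" where
  "dynamical_system M D T \<longleftrightarrow>
     prob_space M \<and>
     D \<subseteq> space M \<and> space M - D \<in> null_sets M \<and>
     T \<in> measurable (restrict_space M D) M \<and>
     (\<forall>B\<in>sets M. measure M (T -` B \<inter> D) = measure M B)"

text \<open>The set of points at which the \<open>n\<close>-th iterate of the partial map is defined.\<close>

definition iter_dom :: "'a set \<Rightarrow> ('a \<Rightarrow> 'a) \<Rightarrow> nat \<Rightarrow> 'a set" where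
  "iter_dom D T n = {x. \<forall>k<n. (T ^^ k) x \<in> D}"

definition fwd_image :: "'a set \<Rightarrow> ('a \<Rightarrow> 'a) \<Rightarrow> nat \<Rightarrow> 'a set \<Rightarrow> 'a set" where
  "fwd_image D T n A = (T ^^ n) ` (A \<inter> iter_dom D T n)"

definition inv_image_iter :: "'a set \<Rightarrow> ('a \<Rightarrow> 'a) \<Rightarrow> nat \<Rightarrow> 'a set \<Rightarrow> 'a set" where
  "inv_image_iter D T n B = (T ^^ n) -` B \<inter> iter_dom D T n"

text \<open>
  The \<open>\<sigma>\<close>-algebra \<open>T\<^sup>-\<^sup>n \<M>\<close>, as usual up to null sets: the equality
  \<open>(\<Inter>n>0. T\<^sup>-\<^sup>n \<M>) = \<N>\<close> defining exactness is an equality modulo null sets, since a null set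
  need not literally be a preimage under every iterate.
\<close>

definition pullback_algebra :: "'a measure \<Rightarrow> 'a set \<Rightarrow> ('a \<Rightarrow> 'a) \<Rightarrow> nat \<Rightarrow> 'a set set" where
  "pullback_algebra M D T n =
     {A \<in> sets M. \<exists>B\<in>sets M. sym_diff A (inv_image_iter D T n B) \<in> null_sets M}"

definition null_conull_algebra :: "'a measure \<Rightarrow> 'a set set" where
  "null_conull_algebra M =
     {A \<in> sets M. A \<in> null_sets M \<or> space M - A \<in> null_sets M}"

text \<open>
  Both formulations of exactness are required. Forward images of measurable sets need not be
  measurable, so the formulation through forward images is asserted for those \<open>A\<close> for which they
  are; the tail formulation carries no such restriction.
\<close>

definition exact_system :: "'a measure \<Rightarrow> 'a set \<Rightarrow> ('a \<Rightarrow> 'a) \<Rightarrow> bool" where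
  "exact_system M D T \<longleftrightarrow>
     dynamical_system M D T \<and>
     (\<Inter>n\<in>{0<..}. pullback_algebra M D T n) = null_conull_algebra M \<and>
     (\<forall>A\<in>sets M. measure M A > 0 \<longrightarrow> (\<forall>n. fwd_image D T n A \<in> sets M) \<longrightarrow>
        (\<lambda>n. measure M (fwd_image D T n A)) \<longlonglongrightarrow> 1)"

definition prod_map :: "'i set \<Rightarrow> ('i \<Rightarrow> 'a \<Rightarrow> 'a) \<Rightarrow> ('i \<Rightarrow> 'a) \<Rightarrow> ('i \<Rightarrow> 'a)" where
  "prod_map I T x = (\<lambda>i\<in>I. T i (x i))"

end

theory Submission
  imports Defs
begin

text \<open>
  Everything rests on a one-sided mixing estimate with a constant \<open>c > 0\<close>: for each measurable \<open>A\<close>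
  and \<open>\<epsilon> > 0\<close>, eventually \<open>\<mu>(A \<inter> T\<^sup>-\<^sup>n B) \<ge> c \<mu>(A) \<mu>(B) - \<epsilon>\<close>, uniformly in \<open>B\<close>.
  For \<open>A\<close> in the given collection and \<open>n \<ge> n(A)\<close> the distortion bound, applied to the part of \<open>A\<close>
  that the \<open>n(A)\<close>-th iterate sends into the preimage of \<open>B\<close> under the remaining iterates, gives it with \<open>c = 1/\<lambda>\<close> and
  \<open>\<epsilon> = 0\<close>. It survives disjoint unions and approximation of \<open>A\<close> in measure, and uniformity in
  \<open>B\<close> lets it pass to products by Fubini, although the times \<open>n\<^sub>i(A\<^sub>i)\<close> in the factors are
  unrelated. It implies exactness: if \<open>A = T\<^sup>-\<^sup>n B\<close>, test it with the complement of \<open>B\<close>; for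
  forward images, test it with the complement of \<open>T\<^sup>n A\<close>.
\<close>

section \<open>Total measure-preserving maps and the spreading estimate\<close>

definition measure_preserving_map :: "'a measure \<Rightarrow> ('a \<Rightarrow> 'a) \<Rightarrow> bool" where
  "measure_preserving_map M S \<longleftrightarrow> S \<in> measurable M M \<and> distr M M S = M"

text \<open>The threshold \<open>N\<close> is chosen before \<open>B\<close>. Hence \<open>B\<close>
  may later be a slice that varies with a point of another factor, or a set that itself depends on
  \<open>n\<close>. The error \<epsilon> is what lets the estimate survive approximation of
  \<open>A\<close> in measure.\<close>

definition spreads_at :: "real \<Rightarrow> 'a measure \<Rightarrow> ('a \<Rightarrow> 'a) \<Rightarrow> 'a set \<Rightarrow> bool" where
  "spreads_at c M S A \<longleftrightarrow>
     (\<forall>\<epsilon>>0. \<exists>N. \<forall>n\<ge>N. \<forall>B\<in>sets M.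
        c * measure M A * measure M B - \<epsilon> \<le> measure M (A \<inter> (S ^^ n) -` B))"

definition spreads :: "real \<Rightarrow> 'a measure \<Rightarrow> ('a \<Rightarrow> 'a) \<Rightarrow> bool" where
  "spreads c M S \<longleftrightarrow> (\<forall>A\<in>sets M. spreads_at c M S A)"

lemma spreads_atD:
  assumes "spreads_at c M S A" "\<epsilon> > 0"
  obtains N where "\<And>n B. n \<ge> N \<Longrightarrow> B \<in> sets M \<Longrightarrow>
    c * measure M A * measure M B - \<epsilon> \<le> measure M (A \<inter> (S ^^ n) -` B)"
  using assms unfolding spreads_at_def by blast

lemma measure_preserving_map_funpow:
  assumes "measure_preserving_map M S"
  shows "S ^^ n \<in> measurable M M"
  using assms unfolding measure_preserving_map_def
  by (induction n) (auto intro: measurable_comp)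

lemma measure_preserving_map_funpow_sets:
  assumes "measure_preserving_map M S" "A \<in> sets M" "B \<in> sets M"
  shows "A \<inter> (S ^^ n) -` B \<in> sets M"
proof -
  have "A \<inter> (S ^^ n) -` B = A \<inter> ((S ^^ n) -` B \<inter> space M)"
    using sets.sets_into_space[OF assms(2)] by auto
  then show ?thesis
    using assms measurable_sets[OF measure_preserving_map_funpow[OF assms(1)] assms(3)] by auto
qed

lemma distr_funpow_measure_preserving:
  assumes "measure_preserving_map M S"
  shows "distr M M (S ^^ n) = M"
proof (induction n)
  case 0
  show ?case by (simp add: distr_id2 id_def)
next
  case (Suc n)
  have "distr M M (S ^^ Suc n) = distr (distr M M (S ^^ n)) M S"
    using assms measure_preserving_map_funpow[OF assms]
    by (subst distr_distr) (auto simp: measure_preserving_map_def)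
  also have "\<dots> = M"
    unfolding Suc.IH using assms by (simp add: measure_preserving_map_def)
  finally show ?case .
qed

lemma measure_vimage_funpow:
  assumes "measure_preserving_map M S" "B \<in> sets M"
  shows "measure M ((S ^^ n) -` B \<inter> space M) = measure M B"
  using measure_distr[OF measure_preserving_map_funpow[OF assms(1)] assms(2), of n]
  by (simp add: distr_funpow_measure_preserving[OF assms(1)])

subsection \<open>Permanence of the spreading property\<close>

lemma (in finite_measure) measure_le_plus_sym_diff:
  assumes "A \<in> sets M" "B \<in> sets M"
  shows "measure M A \<le> measure M B + measure M (sym_diff A B)"
proof -
  have "measure M A \<le> measure M (B \<union> sym_diff A B)"
    using assms by (intro finite_measure_mono) auto
  also have "\<dots> \<le> measure M B + measure M (sym_diff A B)"
    using assms by (intro measure_Un_le) auto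
  finally show ?thesis .
qed

text \<open>Exchanging \<open>A\<close> for a nearby \<open>A'\<close> changes both sides by an
  amount that does not depend on \<open>n\<close> or \<open>B\<close>, so the threshold found for
  \<open>A'\<close> also serves \<open>A\<close>.\<close>

lemma (in prob_space) spreads_at_approx:
  assumes mp: "measure_preserving_map M S" and c: "c \<ge> 0" and A: "A \<in> sets M"
    and approx: "\<And>\<epsilon>. \<epsilon> > 0 \<Longrightarrow> \<exists>A'\<in>sets M. spreads_at c M S A' \<and> measure M (sym_diff A A') < \<epsilon>"
  shows "spreads_at c M S A"
  unfolding spreads_at_def
proof (intro allI impI)
  fix \<epsilon> :: real assume "\<epsilon> > 0"
  \<comment> \<open>Three losses have to fit into \<epsilon>: \<delta> from the estimate for
    \<open>A'\<close>, \<delta> from exchanging the intersections, and \<open>c * \<delta>\<close>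
    from exchanging the measures on the left.\<close>
  define \<delta> where "\<delta> = \<epsilon> / (2 + c)"
  have "\<delta> > 0" "(2 + c) * \<delta> = \<epsilon>"
    using \<open>\<epsilon> > 0\<close> c by (auto simp: \<delta>_def)
  then have \<delta>: "\<delta> > 0" "c * \<delta> + \<delta> + \<delta> = \<epsilon>"
    by (auto simp: algebra_simps)
  obtain A' where A': "A' \<in> sets M" "spreads_at c M S A'" "measure M (sym_diff A A') < \<delta>"
    using approx[OF \<delta>(1)] by auto
  obtain N where N: "\<And>n B. n \<ge> N \<Longrightarrow> B \<in> sets M \<Longrightarrow>
    c * measure M A' * measure M B - \<delta> \<le> measure M (A' \<inter> (S ^^ n) -` B)"
    using spreads_atD[OF A'(2) \<delta>(1)] by blast
  show "\<exists>N. \<forall>n\<ge>N. \<forall>B\<in>sets M. c * measure M A * measure M B - \<epsilon> \<le> measure M (A \<inter> (S ^^ n) -` B)"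
  proof (intro exI[of _ N] allI impI ballI)
    fix n B assume n: "n \<ge> N" and B: "B \<in> sets M"
    let ?P = "(S ^^ n) -` B"
    note meas = measure_preserving_map_funpow_sets[OF mp _ B, of _ n]
    have "measure M (A' \<inter> ?P) \<le> measure M (A \<inter> ?P) + measure M (sym_diff (A' \<inter> ?P) (A \<inter> ?P))"
      using meas A A'(1) by (intro measure_le_plus_sym_diff) auto
    also have "measure M (sym_diff (A' \<inter> ?P) (A \<inter> ?P)) \<le> measure M (sym_diff A A')"
      using A A'(1) by (intro finite_measure_mono) auto
    finally have 1: "measure M (A' \<inter> ?P) \<le> measure M (A \<inter> ?P) + \<delta>"
      using A'(3) by linarith
    have "measure M A \<le> measure M A' + \<delta>"
      using measure_le_plus_sym_diff[OF A A'(1)] A'(3) by linarith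
    then have "measure M A * measure M B \<le> (measure M A' + \<delta>) * measure M B"
      by (rule mult_right_mono) simp
    also have "\<dots> \<le> measure M A' * measure M B + \<delta>"
      using \<delta>(1) prob_le_1[of B] by (simp add: algebra_simps)
    finally have "c * (measure M A * measure M B) \<le> c * (measure M A' * measure M B + \<delta>)"
      using c by (rule mult_left_mono)
    then show "c * measure M A * measure M B - \<epsilon> \<le> measure M (A \<inter> ?P)"
      using 1 N[OF n B] \<delta>(2) by (simp add: algebra_simps)
  qed
qed

text \<open>Both sides of the estimate are additive over disjoint sets; the error is split evenly
  and the later threshold is taken.\<close>

lemma (in prob_space) spreads_at_disjoint_Un:
  assumes mp: "measure_preserving_map M S"
    and A: "A \<in> sets M" "spreads_at c M S A" and A': "A' \<in> sets M" "spreads_at c M S A'"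
    and disj: "A \<inter> A' = {}"
  shows "spreads_at c M S (A \<union> A')"
  unfolding spreads_at_def
proof (intro allI impI)
  fix \<epsilon> :: real assume "\<epsilon> > 0"
  then have \<epsilon>2: "\<epsilon> / 2 > 0" by simp
  obtain N where N: "\<And>n B. n \<ge> N \<Longrightarrow> B \<in> sets M \<Longrightarrow>
      c * measure M A * measure M B - \<epsilon> / 2 \<le> measure M (A \<inter> (S ^^ n) -` B)"
    using spreads_atD[OF A(2) \<epsilon>2] by blast
  obtain N' where N': "\<And>n B. n \<ge> N' \<Longrightarrow> B \<in> sets M \<Longrightarrow>
      c * measure M A' * measure M B - \<epsilon> / 2 \<le> measure M (A' \<inter> (S ^^ n) -` B)"
    using spreads_atD[OF A'(2) \<epsilon>2] by blast
  show "\<exists>N. \<forall>n\<ge>N. \<forall>B\<in>sets M.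
      c * measure M (A \<union> A') * measure M B - \<epsilon> \<le> measure M ((A \<union> A') \<inter> (S ^^ n) -` B)"
  proof (intro exI[of _ "max N N'"] allI impI ballI)
    fix n B assume n: "n \<ge> max N N'" and B: "B \<in> sets M"
    note meas = measure_preserving_map_funpow_sets[OF mp _ B, of _ n]
    have "measure M ((A \<union> A') \<inter> (S ^^ n) -` B)
        = measure M (A \<inter> (S ^^ n) -` B) + measure M (A' \<inter> (S ^^ n) -` B)"
      unfolding Int_Un_distrib2 using meas A(1) A'(1) disj
      by (intro finite_measure_Union) auto
    moreover have "measure M (A \<union> A') = measure M A + measure M A'"
      using A(1) A'(1) disj by (intro finite_measure_Union) auto
    ultimately show "c * measure M (A \<union> A') * measure M B - \<epsilon>
        \<le> measure M ((A \<union> A') \<inter> (S ^^ n) -` B)"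
      using N[of n B] N'[of n B] n B by (simp add: algebra_simps)
  qed
qed

lemma spreads_at_measure_0:
  assumes "measure M A = 0"
  shows "spreads_at c M S A"
  using assms unfolding spreads_at_def by (auto intro!: order.trans[OF _ measure_nonneg])

text \<open>Finiteness keeps a common threshold available: the thresholds of infinitely many pieces
  may be unbounded. Countable unions are reached by approximation instead.\<close>

lemma (in prob_space) spreads_at_finite_Union:
  assumes mp: "measure_preserving_map M S"
    and "finite \<C>" "disjoint \<C>" "\<C> \<subseteq> sets M" "\<And>A. A \<in> \<C> \<Longrightarrow> spreads_at c M S A"
  shows "spreads_at c M S (\<Union>\<C>)"
  using assms(2-)
proof (induction \<C>)
  case empty
  show ?case by (simp add: spreads_at_measure_0)
next
  case (insert A \<C>)
  have "spreads_at c M S (A \<union> \<Union>\<C>)"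
  proof (rule spreads_at_disjoint_Un[OF mp])
    show "\<Union>\<C> \<in> sets M" using insert by (intro sets.finite_Union) auto
    show "spreads_at c M S (\<Union>\<C>)" using insert by (auto simp: disjoint_def)
    show "A \<inter> \<Union>\<C> = {}" using insert.prems(1) insert.hyps(2) by (auto simp: disjoint_def)
  qed (use insert in auto)
  then show ?case by simp
qed

text \<open>Continuity from below along an enumeration of the family.\<close>

lemma (in finite_measure) countable_Union_approx:
  assumes "countable \<C>" "\<C> \<subseteq> sets M" "\<epsilon> > 0"
  obtains \<F> where "finite \<F>" "\<F> \<subseteq> \<C>" "measure M (\<Union>\<C> - \<Union>\<F>) < \<epsilon>"
proof (cases "\<C> = {}")
  case True
  then show ?thesis using that[of "{}"] assms(3) by auto
next
  case False
  \<comment> \<open>\<open>from_nat_into\<close> enumerates a nonempty countable family, with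
    repetitions if it is finite; hence the separate case of the empty family.\<close>
  define f where "f = from_nat_into \<C>"
  have f: "range f = \<C>"
    using False assms(1) by (simp add: f_def range_from_nat_into)
  define U where "U k = \<Union> (f ` {..<k})" for k
  have U: "U k \<in> sets M" for k
    unfolding U_def using f assms(2) by (intro sets.finite_Union) auto
  have "(\<lambda>k. measure M (U k)) \<longlonglongrightarrow> measure M (\<Union>k. U k)"
    using U by (intro finite_Lim_measure_incseq) (auto simp: incseq_def U_def, force)
  moreover have UN: "(\<Union>k. U k) = \<Union>\<C>"
    unfolding U_def f[symmetric] by auto
  ultimately have "\<forall>\<^sub>F k in sequentially. measure M (U k) > measure M (\<Union>\<C>) - \<epsilon>"
    using assms(3) by (intro order_tendstoD(1)) auto
  then obtain k where k: "measure M (U k) > measure M (\<Union>\<C>) - \<epsilon>"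
    by (meson eventually_at_top_linorder order_refl)
  have "\<Union>\<C> \<in> sets M" using assms by (intro sets.countable_Union) auto
  moreover have "U k \<subseteq> \<Union>\<C>" using UN by auto
  ultimately have "measure M (\<Union>\<C> - U k) = measure M (\<Union>\<C>) - measure M (U k)"
    using U by (intro finite_measure_Diff) auto
  then have "measure M (\<Union>\<C> - U k) < \<epsilon>"
    using k by linarith
  then show ?thesis
    using that[of "f ` {..<k}"] f by (auto simp: U_def)
qed

lemma (in finite_measure) measure_sym_diff_triangle:
  assumes "A \<in> sets M" "B \<in> sets M" "C \<in> sets M"
  shows "measure M (sym_diff A C) \<le> measure M (sym_diff A B) + measure M (sym_diff B C)"
proof -
  have "measure M (sym_diff A C) \<le> measure M (sym_diff A B \<union> sym_diff B C)"
    using assms by (intro finite_measure_mono) auto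
  also have "\<dots> \<le> measure M (sym_diff A B) + measure M (sym_diff B C)"
    using assms by (intro measure_Un_le) auto
  finally show ?thesis .
qed

text \<open>Half of the error buys a countable disjoint union of members of \<open>\<A>\<close>, the
  other half cuts it down to a finite one. This serves twice: for the given collection in each
  factor and for the rectangles in a product.\<close>

lemma (in prob_space) spreads_if_approximable:
  assumes mp: "measure_preserving_map M S" and c: "c \<ge> 0" and \<A>: "\<A> \<subseteq> sets M"
    and sp: "\<And>A. A \<in> \<A> \<Longrightarrow> spreads_at c M S A"
    and approx: "\<And>B \<epsilon>. B \<in> sets M \<Longrightarrow> \<epsilon> > 0 \<Longrightarrow>
          \<exists>\<C>. \<C> \<subseteq> \<A> \<and> countable \<C> \<and> disjoint \<C> \<and> measure M (sym_diff B (\<Union>\<C>)) < \<epsilon>"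
  shows "spreads c M S"
  unfolding spreads_def
proof (intro ballI spreads_at_approx[OF mp c])
  fix B and \<epsilon> :: real assume B: "B \<in> sets M" and "\<epsilon> > 0"
  then have \<epsilon>2: "\<epsilon> / 2 > 0" by simp
  obtain \<C> where \<C>: "\<C> \<subseteq> \<A>" "countable \<C>" "disjoint \<C>"
      "measure M (sym_diff B (\<Union>\<C>)) < \<epsilon> / 2"
    using approx[OF B \<epsilon>2] by blast
  obtain \<F> where \<F>: "finite \<F>" "\<F> \<subseteq> \<C>" "measure M (\<Union>\<C> - \<Union>\<F>) < \<epsilon> / 2"
    using countable_Union_approx[OF \<C>(2) _ \<epsilon>2] \<C>(1) \<A> by blast
  have sets: "\<Union>\<C> \<in> sets M" "\<Union>\<F> \<in> sets M"
    using \<C>(1,2) \<F>(1,2) \<A> by (auto intro: sets.countable_Union sets.finite_Union)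
  have "spreads_at c M S (\<Union>\<F>)"
    using \<C>(1,3) \<F>(1,2) \<A> by (intro spreads_at_finite_Union[OF mp] sp) (auto simp: disjoint_def)
  moreover have "sym_diff (\<Union>\<C>) (\<Union>\<F>) = \<Union>\<C> - \<Union>\<F>"
    using \<F>(2) by auto
  then have "measure M (sym_diff B (\<Union>\<F>)) < \<epsilon>"
    using measure_sym_diff_triangle[OF B sets] \<C>(4) \<F>(3) by simp
  ultimately show "\<exists>A'\<in>sets M. spreads_at c M S A' \<and> measure M (sym_diff B A') < \<epsilon>"
    using sets by blast
qed

section \<open>Passage to factors\<close>

text \<open>Taking preimages under \<open>\<pi>\<close> preserves measures, and equivariance turns
  preimages under iterates of \<open>R\<close> into preimages under iterates of \<open>S\<close>. So
  the estimate on \<open>Y\<close> is the estimate on \<open>X\<close> for sets pulled back from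
  \<open>Y\<close>, with the same threshold.\<close>

lemma spreads_factor:
  assumes \<pi>: "\<pi> \<in> measurable X Y" "distr X Y \<pi> = Y"
    and mp: "measure_preserving_map X S" "measure_preserving_map Y R"
    and comm: "\<And>x. x \<in> space X \<Longrightarrow> R (\<pi> x) = \<pi> (S x)"
    and sp: "spreads c X S"
  shows "spreads c Y R"
  unfolding spreads_def spreads_at_def
proof (intro ballI allI impI)
  fix A and \<epsilon> :: real assume A: "A \<in> sets Y" and "\<epsilon> > 0"
  have meas: "measure Y E = measure X (\<pi> -` E \<inter> space X)" if "E \<in> sets Y" for E
    using measure_distr[OF \<pi>(1) that] \<pi>(2) by simp
  have commn: "(R ^^ n) (\<pi> x) = \<pi> ((S ^^ n) x)" if "x \<in> space X" for x n
  proof (induction n)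
    case (Suc n)
    have "(S ^^ n) x \<in> space X"
      using measurable_space[OF measure_preserving_map_funpow[OF mp(1)] that] .
    then show ?case using Suc comm by simp
  qed simp
  obtain N where N: "\<And>n B. n \<ge> N \<Longrightarrow> B \<in> sets X \<Longrightarrow>
      c * measure X (\<pi> -` A \<inter> space X) * measure X B - \<epsilon>
        \<le> measure X ((\<pi> -` A \<inter> space X) \<inter> (S ^^ n) -` B)"
    using sp measurable_sets[OF \<pi>(1) A] \<open>\<epsilon> > 0\<close> unfolding spreads_def
    by (metis spreads_atD)
  show "\<exists>N. \<forall>n\<ge>N. \<forall>B\<in>sets Y. c * measure Y A * measure Y B - \<epsilon> \<le> measure Y (A \<inter> (R ^^ n) -` B)"
  proof (intro exI[of _ N] allI impI ballI)
    fix n B assume n: "n \<ge> N" and B: "B \<in> sets Y"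
    have "(\<pi> -` A \<inter> space X) \<inter> (S ^^ n) -` (\<pi> -` B \<inter> space X)
        = \<pi> -` (A \<inter> (R ^^ n) -` B) \<inter> space X"
      using measurable_space[OF measure_preserving_map_funpow[OF mp(1)]] by (auto simp: commn)
    then show "c * measure Y A * measure Y B - \<epsilon> \<le> measure Y (A \<inter> (R ^^ n) -` B)"
      using N[OF n measurable_sets[OF \<pi>(1) B]] A B
        measure_preserving_map_funpow_sets[OF mp(2) A B, of n]
      by (simp add: meas)
  qed
qed

lemma measure_preserving_map_factor:
  assumes \<pi>: "\<pi> \<in> measurable X Y" "distr X Y \<pi> = Y"
    and mp: "measure_preserving_map X S" and R: "R \<in> measurable Y Y"
    and comm: "\<And>x. x \<in> space X \<Longrightarrow> R (\<pi> x) = \<pi> (S x)"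
  shows "measure_preserving_map Y R"
proof -
  have S: "S \<in> measurable X X" "distr X X S = X"
    using mp by (auto simp: measure_preserving_map_def)
  have "distr Y Y R = distr (distr X Y \<pi>) Y R" by (simp add: \<pi>(2))
  also have "\<dots> = distr X Y (R \<circ> \<pi>)" using R \<pi>(1) by (rule distr_distr)
  also have "\<dots> = distr X Y (\<pi> \<circ> S)" by (rule distr_cong) (auto simp: comm)
  also have "\<dots> = distr (distr X X S) Y \<pi>" using \<pi>(1) S(1) by (rule distr_distr[symmetric])
  also have "\<dots> = Y" by (simp add: S(2) \<pi>(2))
  finally show ?thesis using R by (simp add: measure_preserving_map_def)
qed

subsection \<open>Products\<close>

text \<open>The sets that can be approximated by \<open>\<R>\<close> contain \<open>\<R>\<close> and
  are closed under complements and countable unions, which is an induction over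
  \<open>sigma_sets\<close>.\<close>

lemma (in finite_measure) approx_by_algebra:
  assumes alg: "algebra (space M) \<R>" and gen: "sets M = sigma_sets (space M) \<R>"
    and A: "A \<in> sets M" and "\<epsilon> > 0"
  shows "\<exists>A'\<in>\<R>. measure M (sym_diff A A') < \<epsilon>"
proof -
  interpret R: algebra "space M" \<R> by fact
  have sub: "\<R> \<subseteq> sets M" unfolding gen by auto
  from A \<open>\<epsilon> > 0\<close> show ?thesis
    unfolding gen
  proof (induction A arbitrary: \<epsilon> rule: sigma_sets.induct)
    case (Basic a)
    then show ?case by (intro bexI[of _ a]) auto
  next
    case Empty
    then show ?case by (intro bexI[of _ "{}"]) auto
  next
    case (Compl a)
    then obtain a' where a': "a' \<in> \<R>" "measure M (sym_diff a a') < \<epsilon>" by blast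
    have "a \<subseteq> space M" using Compl.hyps gen sets.sets_into_space by blast
    moreover have "a' \<subseteq> space M" using a'(1) R.sets_into_space by blast
    ultimately have "sym_diff (space M - a) (space M - a') = sym_diff a a'" by auto
    then show ?case using a' by (intro bexI[of _ "space M - a'"]) auto
  next
    case (Union a)
    have a: "a i \<in> sets M" for i using Union.hyps gen by auto
    then have "range a \<subseteq> sets M" by auto
    then obtain \<F> where \<F>: "finite \<F>" "\<F> \<subseteq> range a" "measure M (\<Union>(range a) - \<Union>\<F>) < \<epsilon> / 2"
      using countable_Union_approx[of "range a" "\<epsilon> / 2"] Union.prems by auto
    obtain J where J: "finite J" "\<F> = a ` J"
      using \<F>(1,2) by (meson finite_subset_image subset_UNIV)
    \<comment> \<open>The finitely many remaining sets share an error of \<epsilon>/2; the added 1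
      keeps the denominator positive when \<open>J\<close> is empty.\<close>
    define \<delta> where "\<delta> = \<epsilon> / 2 / (real (card J) + 1)"
    have \<delta>: "\<delta> > 0" "real (card J) * \<delta> \<le> \<epsilon> / 2"
      using Union.prems by (auto simp: \<delta>_def field_simps)
    have "\<exists>a'\<in>\<R>. measure M (sym_diff (a i) a') < \<delta>" for i
      using Union.IH \<delta>(1) by blast
    then obtain a' where a': "\<And>i. a' i \<in> \<R>" "\<And>i. measure M (sym_diff (a i) (a' i)) < \<delta>"
      by metis
    have UJ: "(\<Union>i\<in>J. a' i) \<in> \<R>" using J(1) a'(1) by (intro R.finite_UN) auto
    have a'M: "a' i \<in> sets M" for i using a'(1) sub by auto
    have "measure M (sym_diff (\<Union>i\<in>J. a i) (\<Union>i\<in>J. a' i))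
        \<le> measure M (\<Union>i\<in>J. sym_diff (a i) (a' i))"
      using a a'M J(1) by (intro finite_measure_mono) (auto intro!: sets.finite_UN)
    also have "\<dots> \<le> (\<Sum>i\<in>J. measure M (sym_diff (a i) (a' i)))"
      using a a'M J(1) by (intro measure_UNION_le) auto
    also have "\<dots> \<le> (\<Sum>i\<in>J. \<delta>)"
      using a'(2) by (intro sum_mono) (auto intro: less_imp_le)
    finally have 1: "measure M (sym_diff (\<Union>i\<in>J. a i) (\<Union>i\<in>J. a' i)) \<le> \<epsilon> / 2"
      using \<delta>(2) by simp
    have "sym_diff (\<Union>i. a i) (\<Union>i\<in>J. a i) = \<Union>(range a) - \<Union>\<F>"
      using J(2) by auto
    with \<F>(3) have 2: "measure M (sym_diff (\<Union>i. a i) (\<Union>i\<in>J. a i)) < \<epsilon> / 2"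
      by simp
    have "measure M (sym_diff (\<Union>i. a i) (\<Union>i\<in>J. a' i)) < \<epsilon>"
      using measure_sym_diff_triangle[of "\<Union>i. a i" "\<Union>i\<in>J. a i" "\<Union>i\<in>J. a' i"] 1 2 a a'M J(1)
      by (force intro!: sets.finite_UN)
    then show ?case using UJ by blast
  qed
qed

text \<open>Needed because the ring generated by a semiring of sets consists of finite disjoint
  unions of its members, so disjointness of the approximating rectangles comes for free.\<close>

lemma semiring_of_rectangles:
  "semiring_of_sets (space M1 \<times> space M2) {a \<times> b |a b. a \<in> sets M1 \<and> b \<in> sets M2}"
    (is "semiring_of_sets _ ?R")
proof
  have rect: "a \<times> b \<in> ?R" if "a \<in> sets M1" "b \<in> sets M2" for a b
    using that by blast
  show "?R \<subseteq> Pow (space M1 \<times> space M2)"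
  proof
    fix p assume "p \<in> ?R"
    then obtain a b where "p = a \<times> b" "a \<in> sets M1" "b \<in> sets M2" by blast
    then show "p \<in> Pow (space M1 \<times> space M2)"
      using sets.sets_into_space[of a M1] sets.sets_into_space[of b M2] by auto
  qed
  show "{} \<in> ?R" using rect[of "{}" "{}"] by simp
  fix p q assume "p \<in> ?R" "q \<in> ?R"
  then obtain a b a' b' where ab: "p = a \<times> b" "a \<in> sets M1" "b \<in> sets M2"
    "q = a' \<times> b'" "a' \<in> sets M1" "b' \<in> sets M2" by blast
  show "p \<inter> q \<in> ?R"
    unfolding ab(1,4) Times_Int_Times using ab by (intro rect) auto
  \<comment> \<open>A point of the difference either has its first coordinate outside
    \<open>a'\<close>, or has it inside \<open>a'\<close> and its second coordinate outside
    \<open>b'\<close>.\<close>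
  let ?C = "{(a - a') \<times> b, (a \<inter> a') \<times> (b - b')}"
  have "?C \<subseteq> ?R" using rect[of "a - a'" b] rect[of "a \<inter> a'" "b - b'"] ab by simp
  moreover have "disjoint ?C" by (auto simp: disjoint_def)
  moreover have "p - q = \<Union>?C" unfolding ab(1,4) by auto
  ultimately show "\<exists>C\<subseteq>?R. finite C \<and> disjoint C \<and> p - q = \<Union>C"
    by (intro exI[of _ ?C] conjI) simp_all
qed

context pair_prob_space
begin

text \<open>The ring generated by the rectangles contains the whole space, hence is an algebra, and
  it generates the product \<sigma>-algebra.\<close>

lemma approx_by_rectangles:
  assumes "A \<in> sets (M1 \<Otimes>\<^sub>M M2)" "\<epsilon> > 0"
  shows "\<exists>\<C>. finite \<C> \<and> disjoint \<C> \<and> \<C> \<subseteq> {a \<times> b |a b. a \<in> sets M1 \<and> b \<in> sets M2} \<and>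
    measure (M1 \<Otimes>\<^sub>M M2) (sym_diff A (\<Union>\<C>)) < \<epsilon>"
proof -
  let ?R = "{a \<times> b |a b. a \<in> sets M1 \<and> b \<in> sets M2}"
  interpret R: semiring_of_sets "space M1 \<times> space M2" ?R
    by (rule semiring_of_rectangles)
  interpret G: ring_of_sets "space M1 \<times> space M2" R.generated_ring
    by (rule R.generating_ring)
  have top: "space M1 \<times> space M2 \<in> R.generated_ring"
    by (intro R.generated_ringI_Basic) auto
  have alg: "algebra (space (M1 \<Otimes>\<^sub>M M2)) R.generated_ring"
    unfolding space_pair_measure using top by unfold_locales
  have "R.generated_ring \<subseteq> sets (M1 \<Otimes>\<^sub>M M2)"
    by (auto simp: R.generated_ring_def intro!: sets.finite_Union)
  moreover have "sigma_sets (space M1 \<times> space M2) ?R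
      \<subseteq> sigma_sets (space M1 \<times> space M2) R.generated_ring"
    by (intro sigma_sets_mono') (rule subsetI, rule R.generated_ringI_Basic)
  ultimately have "sets (M1 \<Otimes>\<^sub>M M2) = sigma_sets (space (M1 \<Otimes>\<^sub>M M2)) R.generated_ring"
    using sets.sigma_sets_subset[of R.generated_ring "M1 \<Otimes>\<^sub>M M2"]
    by (auto simp: sets_pair_measure space_pair_measure)
  from P.approx_by_algebra[OF alg this assms] show ?thesis
    by (auto simp: R.generated_ring_def)
qed



section \<open>Fubini: inequalities slice by slice\<close>

lemma integrable_measure_slice1:
  assumes "Q \<in> sets (M1 \<Otimes>\<^sub>M M2)"
  shows "integrable M2 (\<lambda>y. measure M1 ((\<lambda>x. (x, y)) -` Q))"
proof (rule M2.integrable_const_bound[where B=1])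
  show "(\<lambda>y. measure M1 ((\<lambda>x. (x, y)) -` Q)) \<in> borel_measurable M2"
    unfolding measure_def using measurable_emeasure_Pair2[OF assms] by measurable
qed auto

lemma integrable_measure_slice2:
  assumes "Q \<in> sets (M1 \<Otimes>\<^sub>M M2)"
  shows "integrable M1 (\<lambda>x. measure M2 (Pair x -` Q))"
proof (rule M1.integrable_const_bound[where B=1])
  show "(\<lambda>x. measure M2 (Pair x -` Q)) \<in> borel_measurable M1"
    unfolding measure_def using measurable_emeasure_Pair1[OF assms] by measurable
qed auto

lemma measure_pair_slices1:
  assumes "Q \<in> sets (M1 \<Otimes>\<^sub>M M2)"
  shows "measure (M1 \<Otimes>\<^sub>M M2) Q = (LINT y|M2. measure M1 ((\<lambda>x. (x, y)) -` Q))"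
proof -
  have "ennreal (measure (M1 \<Otimes>\<^sub>M M2) Q) = (\<integral>\<^sup>+y. measure M1 ((\<lambda>x. (x, y)) -` Q) \<partial>M2)"
    using emeasure_pair_measure_alt2[OF assms]
    by (simp add: P.emeasure_eq_measure M1.emeasure_eq_measure)
  then show ?thesis
    using integrable_measure_slice1[OF assms]
    by (subst (asm) nn_integral_eq_integral) (auto intro!: integral_nonneg)
qed

lemma measure_pair_slices2:
  assumes "Q \<in> sets (M1 \<Otimes>\<^sub>M M2)"
  shows "measure (M1 \<Otimes>\<^sub>M M2) Q = (LINT x|M1. measure M2 (Pair x -` Q))"
proof -
  have "ennreal (measure (M1 \<Otimes>\<^sub>M M2) Q) = (\<integral>\<^sup>+x. measure M2 (Pair x -` Q) \<partial>M1)"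
    using M2.emeasure_pair_measure_alt[OF assms]
    by (simp add: P.emeasure_eq_measure M2.emeasure_eq_measure)
  then show ?thesis
    using integrable_measure_slice2[OF assms]
    by (subst (asm) nn_integral_eq_integral) (auto intro!: integral_nonneg)
qed

text \<open>An inequality valid on every slice is integrated over the other factor; the constant
  \<epsilon> survives unchanged because that factor has total mass 1.\<close>

lemma measure_pair_le_slices1:
  assumes Q: "Q \<in> sets (M1 \<Otimes>\<^sub>M M2)" "Q' \<in> sets (M1 \<Otimes>\<^sub>M M2)"
    and le: "\<And>y. y \<in> space M2 \<Longrightarrow>
      k * measure M1 ((\<lambda>x. (x, y)) -` Q') - \<epsilon> \<le> measure M1 ((\<lambda>x. (x, y)) -` Q)"
  shows "k * measure (M1 \<Otimes>\<^sub>M M2) Q' - \<epsilon> \<le> measure (M1 \<Otimes>\<^sub>M M2) Q"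
proof -
  note int = integrable_measure_slice1[OF Q(1)] integrable_measure_slice1[OF Q(2)]
  have "(LINT y|M2. k * measure M1 ((\<lambda>x. (x, y)) -` Q') - \<epsilon>)
      \<le> (LINT y|M2. measure M1 ((\<lambda>x. (x, y)) -` Q))"
    using int le by (intro integral_mono) auto
  then show ?thesis
    using int by (simp add: measure_pair_slices1[OF Q(1)] measure_pair_slices1[OF Q(2)]
        M2.prob_space)
qed

lemma measure_pair_le_slices2:
  assumes Q: "Q \<in> sets (M1 \<Otimes>\<^sub>M M2)" "Q' \<in> sets (M1 \<Otimes>\<^sub>M M2)"
    and le: "\<And>x. x \<in> space M1 \<Longrightarrow>
      k * measure M2 (Pair x -` Q') - \<epsilon> \<le> measure M2 (Pair x -` Q)"
  shows "k * measure (M1 \<Otimes>\<^sub>M M2) Q' - \<epsilon> \<le> measure (M1 \<Otimes>\<^sub>M M2) Q"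
proof -
  note int = integrable_measure_slice2[OF Q(1)] integrable_measure_slice2[OF Q(2)]
  have "(LINT x|M1. k * measure M2 (Pair x -` Q') - \<epsilon>)
      \<le> (LINT x|M1. measure M2 (Pair x -` Q))"
    using int le by (intro integral_mono) auto
  then show ?thesis
    using int by (simp add: measure_pair_slices2[OF Q(1)] measure_pair_slices2[OF Q(2)]
        M1.prob_space)
qed

lemma measure_preserving_map_prod:
  assumes "measure_preserving_map M1 S1" "measure_preserving_map M2 S2"
  shows "measure_preserving_map (M1 \<Otimes>\<^sub>M M2) (map_prod S1 S2)"
proof -
  have S: "S1 \<in> measurable M1 M1" "distr M1 M1 S1 = M1" "S2 \<in> measurable M2 M2" "distr M2 M2 S2 = M2"
    using assms by (auto simp: measure_preserving_map_def)
  have eq: "map_prod S1 S2 = (\<lambda>(x, y). (S1 x, S2 y))" by (auto simp: fun_eq_iff)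
  have "distr M1 M1 S1 \<Otimes>\<^sub>M distr M2 M2 S2
      = distr (M1 \<Otimes>\<^sub>M M2) (M1 \<Otimes>\<^sub>M M2) (\<lambda>(x, y). (S1 x, S2 y))"
    by (rule pair_measure_distr) (use S M2.sigma_finite_measure_axioms in auto)
  then show ?thesis
    using S unfolding measure_preserving_map_def eq by simp
qed

text \<open>
  Moving one coordinate at a time keeps the argument at the level of sets: with respect to slices,
  each of the two steps is the estimate for a single factor.
\<close>

lemma spreads_at_rectangle:
  assumes mp: "measure_preserving_map M1 S1" "measure_preserving_map M2 S2"
    and c: "c1 \<ge> 0" and A: "A1 \<in> sets M1" "A2 \<in> sets M2"
    and sp: "spreads_at c1 M1 S1 A1" "spreads_at c2 M2 S2 A2"
  shows "spreads_at (c1 * c2) (M1 \<Otimes>\<^sub>M M2) (map_prod S1 S2) (A1 \<times> A2)"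
  unfolding spreads_at_def
proof (intro allI impI)
  fix \<epsilon> :: real assume "\<epsilon> > 0"
  \<comment> \<open>Moving the first coordinate costs \<delta>. The \<delta> lost in moving the
    second is then multiplied by \<open>c1 * measure M1 A1\<close>, which is at most
    \<open>c1\<close>.\<close>
  define \<delta> where "\<delta> = \<epsilon> / (1 + c1)"
  have "\<delta> > 0" "(1 + c1) * \<delta> = \<epsilon>"
    using \<open>\<epsilon> > 0\<close> c by (auto simp: \<delta>_def)
  then have \<delta>: "\<delta> > 0" "c1 * \<delta> + \<delta> = \<epsilon>" by (auto simp: algebra_simps)
  obtain N1 where N1: "\<And>n B. n \<ge> N1 \<Longrightarrow> B \<in> sets M1 \<Longrightarrow>
      c1 * measure M1 A1 * measure M1 B - \<delta> \<le> measure M1 (A1 \<inter> (S1 ^^ n) -` B)"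
    using spreads_atD[OF sp(1) \<delta>(1)] by blast
  obtain N2 where N2: "\<And>n B. n \<ge> N2 \<Longrightarrow> B \<in> sets M2 \<Longrightarrow>
      c2 * measure M2 A2 * measure M2 B - \<delta> \<le> measure M2 (A2 \<inter> (S2 ^^ n) -` B)"
    using spreads_atD[OF sp(2) \<delta>(1)] by blast
  let ?P = "M1 \<Otimes>\<^sub>M M2"
  show "\<exists>N. \<forall>n\<ge>N. \<forall>B\<in>sets ?P. c1 * c2 * measure ?P (A1 \<times> A2) * measure ?P B - \<epsilon>
      \<le> measure ?P ((A1 \<times> A2) \<inter> (map_prod S1 S2 ^^ n) -` B)"
  proof (intro exI[of _ "max N1 N2"] allI impI ballI)
    fix n B assume n: "n \<ge> max N1 N2" and B: "B \<in> sets ?P"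
    have iter: "map_prod S1 S2 ^^ n = map_prod (S1 ^^ n) (S2 ^^ n)"
      by (induction n) (auto simp: fun_eq_iff)
    define Q where "Q = (A1 \<times> A2) \<inter> (map_prod S1 S2 ^^ n) -` B"
    \<comment> \<open>The intermediate set: only the second coordinate is moved and restricted,
      while the first runs freely through \<open>space M1\<close>. Passing from \<open>B\<close> to
      \<open>Q'\<close> uses the factor \<open>M2\<close> alone, and from \<open>Q'\<close> to
      \<open>Q\<close> the factor \<open>M1\<close> alone.\<close>
    define Q' where "Q' = (space M1 \<times> A2) \<inter> (map_prod id S2 ^^ n) -` B"
    have id: "measure_preserving_map M1 id"
      by (simp add: measure_preserving_map_def id_def distr_id2)
    have iter': "map_prod id S2 ^^ n = map_prod id (S2 ^^ n)"
      by (induction n) (auto simp: fun_eq_iff)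
    have Q: "Q \<in> sets ?P" "Q' \<in> sets ?P"
      unfolding Q_def Q'_def using A B
      by (auto intro!: measure_preserving_map_funpow_sets measure_preserving_map_prod mp id)
    \<comment> \<open>For fixed \<open>y\<close> in \<open>A2\<close>, the slice of \<open>Q\<close>
      is \<open>A1\<close> intersected with the preimage of the slice of \<open>Q'\<close>. That
      slice varies with \<open>y\<close>, and \<open>N1\<close> serves all of them at once.\<close>
    have 1: "c1 * measure M1 A1 * measure ?P Q' - \<delta> \<le> measure ?P Q"
    proof (rule measure_pair_le_slices1[OF Q])
      fix y assume "y \<in> space M2"
      show "c1 * measure M1 A1 * measure M1 ((\<lambda>x. (x, y)) -` Q') - \<delta>
          \<le> measure M1 ((\<lambda>x. (x, y)) -` Q)"
      proof (cases "y \<in> A2")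
        case True
        have "(\<lambda>x. (x, y)) -` Q = A1 \<inter> (S1 ^^ n) -` ((\<lambda>x. (x, y)) -` Q')"
          using True A(1)[THEN sets.sets_into_space]
            measurable_space[OF measure_preserving_map_funpow[OF mp(1)], of _ n]
          by (auto simp: Q_def Q'_def iter iter')
        then show ?thesis
          using N1[of n "(\<lambda>x. (x, y)) -` Q'"] n sets_Pair2[OF Q(2)] by auto
      next
        case False
        then have "(\<lambda>x. (x, y)) -` Q = {}" "(\<lambda>x. (x, y)) -` Q' = {}"
          by (auto simp: Q_def Q'_def)
        then show ?thesis using \<delta>(1) by simp
      qed
    qed
    have 2: "c2 * measure M2 A2 * measure ?P B - \<delta> \<le> measure ?P Q'"
    proof (rule measure_pair_le_slices2[OF Q(2) B])
      fix x assume x: "x \<in> space M1"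
      then have "Pair x -` Q' = A2 \<inter> (S2 ^^ n) -` (Pair x -` B)"
        by (auto simp: Q'_def iter')
      then show "c2 * measure M2 A2 * measure M2 (Pair x -` B) - \<delta> \<le> measure M2 (Pair x -` Q')"
        using N2[of n "Pair x -` B"] n sets_Pair1[OF B] by auto
    qed
    have "c1 * measure M1 A1 * (c2 * measure M2 A2 * measure ?P B - \<delta>)
        \<le> c1 * measure M1 A1 * measure ?P Q'"
      using 2 c by (intro mult_left_mono) auto
    moreover have "c1 * measure M1 A1 * \<delta> \<le> c1 * \<delta>"
      using c \<delta>(1) M1.prob_le_1[of A1] by (intro mult_right_mono) (auto simp: mult_left_le)
    moreover have "measure ?P (A1 \<times> A2) = measure M1 A1 * measure M2 A2"
      using A by (simp add: measure_def M2.emeasure_pair_measure_Times enn2real_mult)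
    ultimately show "c1 * c2 * measure ?P (A1 \<times> A2) * measure ?P B - \<epsilon>
        \<le> measure ?P ((A1 \<times> A2) \<inter> (map_prod S1 S2 ^^ n) -` B)"
      using 1 \<delta>(2) unfolding Q_def[symmetric] by (simp add: algebra_simps)
  qed
qed

text \<open>Only the set \<open>A\<close> has to be approximated by rectangles; on a rectangle the
  estimate already holds against every measurable \<open>B\<close> of the product.\<close>

lemma spreads_prod:
  assumes mp: "measure_preserving_map M1 S1" "measure_preserving_map M2 S2"
    and c: "c1 \<ge> 0" "c2 \<ge> 0" and sp: "spreads c1 M1 S1" "spreads c2 M2 S2"
  shows "spreads (c1 * c2) (M1 \<Otimes>\<^sub>M M2) (map_prod S1 S2)"
proof (rule P.spreads_if_approximable)
  show "measure_preserving_map (M1 \<Otimes>\<^sub>M M2) (map_prod S1 S2)"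
    using mp by (rule measure_preserving_map_prod)
  let ?R = "{a \<times> b |a b. a \<in> sets M1 \<and> b \<in> sets M2}"
  show "?R \<subseteq> sets (M1 \<Otimes>\<^sub>M M2)" by auto
  show "spreads_at (c1 * c2) (M1 \<Otimes>\<^sub>M M2) (map_prod S1 S2) A" if "A \<in> ?R" for A
  proof -
    from that obtain a b where ab: "A = a \<times> b" "a \<in> sets M1" "b \<in> sets M2" by blast
    show ?thesis
      unfolding ab(1) using sp ab(2,3) by (intro spreads_at_rectangle mp c) (auto simp: spreads_def)
  qed
  show "\<exists>\<C>. \<C> \<subseteq> ?R \<and> countable \<C> \<and> disjoint \<C> \<and> measure (M1 \<Otimes>\<^sub>M M2) (sym_diff B (\<Union>\<C>)) < \<epsilon>"
    if "B \<in> sets (M1 \<Otimes>\<^sub>M M2)" "\<epsilon> > 0" for B \<epsilon>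
    using approx_by_rectangles[OF that] by (metis (lifting) countable_finite)
qed (use c in simp)

end

section \<open>Finite products\<close>

text \<open>Induction on \<open>I\<close>: the product over \<open>insert i I\<close> is a factor of
  the binary product of \<open>M i\<close> with the product over \<open>I\<close>, through the map
  that inserts a coordinate. Both conclusions are carried together since the inductive step uses
  both.\<close>

lemma measure_preserving_spreads_PiM:
  assumes "finite I"
    and "\<And>i. i \<in> I \<Longrightarrow> prob_space (M i)"
    and "\<And>i. i \<in> I \<Longrightarrow> measure_preserving_map (M i) (S i)"
    and "\<And>i. i \<in> I \<Longrightarrow> c i \<ge> 0"
    and "\<And>i. i \<in> I \<Longrightarrow> spreads (c i) (M i) (S i)"
  shows "measure_preserving_map (PiM I M) (prod_map I S) \<and>
    spreads (\<Prod>i\<in>I. c i) (PiM I M) (prod_map I S)"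
  using assms
proof (induction I)
  case empty
  have S: "prod_map {} S = (\<lambda>x. \<lambda>i. undefined)" by (auto simp: prod_map_def fun_eq_iff)
  \<comment> \<open>The empty product is a single point of mass 1, where the estimate holds with the
    empty product 1 as constant.\<close>
  have P: "PiM {} M = count_space {\<lambda>k. undefined}" by (rule PiM_empty)
  have iter: "(prod_map {} S ^^ n) (\<lambda>k. undefined) = (\<lambda>k. undefined)" for n
    by (induction n) (auto simp: S)
  have mp: "measure_preserving_map (PiM {} M) (prod_map {} S)"
    unfolding measure_preserving_map_def P S
    by (auto intro!: measure_eqI simp: emeasure_distr subset_singleton_iff)
  moreover have "spreads 1 (PiM {} M) (prod_map {} S)"
    unfolding P spreads_def spreads_at_def
    by (auto simp: subset_singleton_iff iter measure_count_space intro!: exI[of _ 0])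
  ultimately show ?case by simp
next
  case (insert i I)
  interpret Mi: prob_space "M i" using insert by auto
  interpret MI: prob_space "PiM I M" using insert by (intro prob_space_PiM) auto
  interpret pair_prob_space "M i" "PiM I M" ..
  have IH: "measure_preserving_map (PiM I M) (prod_map I S)"
      "spreads (\<Prod>i\<in>I. c i) (PiM I M) (prod_map I S)"
    using insert by auto
  let ?\<pi> = "\<lambda>(x, X). X(i := x)" and ?P = "M i \<Otimes>\<^sub>M PiM I M"
  have \<pi>: "?\<pi> \<in> measurable ?P (PiM (insert i I) M)"
      "distr ?P (PiM (insert i I) M) ?\<pi> = PiM (insert i I) M"
    by (measurable, intro distr_pair_PiM_eq_PiM insert.prems(1)) auto
  have mp: "measure_preserving_map ?P (map_prod (S i) (prod_map I S))"
    using insert.prems(2) IH(1) by (intro measure_preserving_map_prod) auto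
  have sp: "spreads (c i * (\<Prod>i\<in>I. c i)) ?P (map_prod (S i) (prod_map I S))"
    using insert.prems IH by (intro spreads_prod prod_nonneg) auto
  have comm: "prod_map (insert i I) S (?\<pi> x) = ?\<pi> (map_prod (S i) (prod_map I S) x)" for x
    using insert.hyps(2) by (cases x) (auto simp: prod_map_def fun_eq_iff)
  have [measurable]: "S j \<in> measurable (M j) (M j)" if "j \<in> insert i I" for j
    using insert.prems(2)[OF that] by (simp add: measure_preserving_map_def)
  have R: "prod_map (insert i I) S \<in> measurable (PiM (insert i I) M) (PiM (insert i I) M)"
    unfolding prod_map_def by measurable
  have mp': "measure_preserving_map (PiM (insert i I) M) (prod_map (insert i I) S)"
    by (rule measure_preserving_map_factor[where \<pi> = ?\<pi>, OF \<pi> mp R]) (rule comm)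
  have "spreads (c i * (\<Prod>i\<in>I. c i)) (PiM (insert i I) M) (prod_map (insert i I) S)"
    by (rule spreads_factor[where \<pi> = ?\<pi>, OF \<pi> mp mp' _ sp]) (rule comm)
  with mp' show ?case using insert.hyps by simp
qed

subsection \<open>Partially defined maps\<close>

text \<open>Sending the null set outside \<open>D\<close> to an arbitrary point \<open>x0\<close>
  leaves the image measure unchanged. Working with the total map keeps domains of iterates out of
  the spreading estimate.\<close>

lemma dynamical_system_totalize:
  assumes "dynamical_system M D T"
  obtains S where "measure_preserving_map M S" "\<And>x. x \<in> D \<Longrightarrow> S x = T x"
proof -
  interpret prob_space M using assms by (simp add: dynamical_system_def)
  have D: "D \<subseteq> space M" "space M - D \<in> null_sets M" "T \<in> measurable (restrict_space M D) M"
      "\<And>B. B \<in> sets M \<Longrightarrow> measure M (T -` B \<inter> D) = measure M B"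
    using assms by (auto simp: dynamical_system_def)
  have "space M - (space M - D) \<in> sets M" using D(2) by blast
  then have Ds: "D \<in> sets M" using D(1) by (simp add: double_diff)
  obtain x0 where x0: "x0 \<in> space M" using not_empty by blast
  define S where "S x = (if x \<in> D then T x else x0)" for x
  have S: "S \<in> measurable M M"
    unfolding S_def using D Ds x0 by (intro measurable_If_restrict_space_iff[THEN iffD2]) auto
  have "distr M M S = M"
  proof (rule measure_eqI)
    fix B assume "B \<in> sets (distr M M S)"
    then have B: "B \<in> sets M" by simp
    have "T -` B \<inter> space (restrict_space M D) \<in> sets (restrict_space M D)"
      using measurable_sets[OF D(3) B] .
    then have TB: "T -` B \<inter> D \<in> sets M"
      using D(1) Ds by (simp add: space_restrict_space Int_absorb2 sets_restrict_space_iff)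
    have "AE x in M. x \<in> D"
      using AE_not_in[OF D(2)] by (auto elim: AE_mp)
    then have "AE x in M. x \<in> S -` B \<inter> space M \<longleftrightarrow> x \<in> T -` B \<inter> D"
      using AE_space by eventually_elim (auto simp: S_def)
    then have "measure M (S -` B \<inter> space M) = measure M (T -` B \<inter> D)"
      using TB measurable_sets[OF S B] by (intro finite_measure_eq_AE) auto
    then show "emeasure (distr M M S) B = emeasure M B"
      using B S D(4)[OF B] by (simp add: emeasure_distr emeasure_eq_measure)
  qed simp
  with S show ?thesis
    using that[of S] by (auto simp: measure_preserving_map_def S_def)
qed

text \<open>The way back from a total map to the partial one, used for the product system.\<close>

lemma dynamical_systemI:
  assumes "prob_space M" "measure_preserving_map M S" "D \<subseteq> space M" "space M - D \<in> null_sets M"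
    and eq: "\<And>x. x \<in> D \<Longrightarrow> S x = T x"
  shows "dynamical_system M D T"
proof -
  interpret prob_space M by fact
  have S: "S \<in> measurable M M" "distr M M S = M"
    using assms(2) by (auto simp: measure_preserving_map_def)
  have "space M - (space M - D) \<in> sets M" using assms(4) by blast
  then have D: "D \<in> sets M" using assms(3) by (simp add: double_diff)
  have "S \<in> measurable (restrict_space M D) M"
    by (rule measurable_restrict_space1[OF S(1)])
  then have T: "T \<in> measurable (restrict_space M D) M"
    by (rule measurable_cong[THEN iffD1, rotated]) (auto simp: space_restrict_space eq)
  have "measure M (T -` B \<inter> D) = measure M B" if B: "B \<in> sets M" for B
  proof -
    have 1: "T -` B \<inter> D = (S -` B \<inter> space M) \<inter> D" using assms(3) eq by auto
    have "AE x in M. x \<in> D"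
      using AE_not_in[OF assms(4)] by (auto elim: AE_mp)
    then have "measure M (T -` B \<inter> D) = measure M (S -` B \<inter> space M)"
      unfolding 1 using D measurable_sets[OF S(1) B]
      by (intro finite_measure_eq_AE) (auto elim: AE_mp)
    also have "\<dots> = measure M B" using measure_distr[OF S(1) B] S(2) by simp
    finally show ?thesis .
  qed
  then show ?thesis
    using T assms by (simp add: dynamical_system_def)
qed

lemma funpow_eq_on_iter_dom:
  assumes "\<And>x. x \<in> D \<Longrightarrow> S x = T x" "x \<in> iter_dom D T n"
  shows "(S ^^ n) x = (T ^^ n) x"
  using assms(2)
proof (induction n)
  case (Suc n)
  then show ?case using assms(1) by (simp add: iter_dom_def)
qed simp

text \<open>Expressing the domain through \<open>S\<close> makes it accessible to measure theory, as
  the iterates of \<open>S\<close> are measurable and preserve the measure.\<close>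

lemma iter_dom_eq:
  assumes "\<And>x. x \<in> D \<Longrightarrow> S x = T x"
  shows "iter_dom D T n = {x. \<forall>k<n. (S ^^ k) x \<in> D}"
proof (induction n)
  case (Suc n)
  have "iter_dom D T (Suc n) = iter_dom D T n \<inter> {x. (T ^^ n) x \<in> D}"
    by (auto simp: iter_dom_def less_Suc_eq)
  also have "\<dots> = iter_dom D T n \<inter> {x. (S ^^ n) x \<in> D}"
    using funpow_eq_on_iter_dom[of D S T _ n] assms by auto
  finally show ?case unfolding Suc.IH by (auto simp: less_Suc_eq)
qed (simp add: iter_dom_def)

text \<open>Only finitely many conditions are imposed, and each fails on the preimage of a null set
  under a measure-preserving iterate.\<close>

lemma AE_iter_dom:
  assumes mp: "measure_preserving_map M S" and D: "space M - D \<in> null_sets M"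
    and eq: "\<And>x. x \<in> D \<Longrightarrow> S x = T x"
  shows "AE x in M. x \<in> iter_dom D T n"
proof -
  have AE: "AE x in M. x \<in> D"
    using AE_not_in[OF D] by (auto elim: AE_mp)
  have "AE x in M. (S ^^ k) x \<in> D" for k
  proof -
    have "AE x in distr M M (S ^^ k). x \<in> D"
      unfolding distr_funpow_measure_preserving[OF mp] by (rule AE)
    then show ?thesis
      by (rule AE_distrD[OF measure_preserving_map_funpow[OF mp]])
  qed
  then have "AE x in M. \<forall>k\<in>{..<n}. (S ^^ k) x \<in> D"
    by (intro AE_finite_allI) auto
  moreover have "iter_dom D T n = {x. \<forall>k<n. (S ^^ k) x \<in> D}"
    by (rule iter_dom_eq[OF eq])
  ultimately show ?thesis by (simp add: Ball_def)
qed

section \<open>Spreading implies exactness\<close>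

text \<open>Any positive \<open>c\<close> suffices, however small: both forms of exactness come from
  applying the lower bound to an intersection that is in fact null.\<close>

lemma exact_system_if_spreads:
  assumes "prob_space M" and mp: "measure_preserving_map M S"
    and D: "D \<subseteq> space M" "space M - D \<in> null_sets M"
    and eq: "\<And>x. x \<in> D \<Longrightarrow> S x = T x"
    and c: "c > 0" and sp: "spreads c M S"
  shows "exact_system M D T"
proof -
  interpret prob_space M by fact
  have ds: "dynamical_system M D T"
    using assms by (intro dynamical_systemI[of M S]) auto
  have "space M - (space M - D) \<in> sets M" using D(2) by blast
  then have Ds: "D \<in> sets M" using D(1) by (simp add: double_diff)
  have AE_dom: "AE x in M. x \<in> iter_dom D T k" for k
    using mp D(2) eq by (rule AE_iter_dom)
  have iter_dom: "iter_dom D T k = {x. \<forall>j<k. (S ^^ j) x \<in> D}" for k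
    using eq by (rule iter_dom_eq)
  have fp: "(S ^^ k) x = (T ^^ k) x" if "x \<in> iter_dom D T k" for x k
    using eq that by (rule funpow_eq_on_iter_dom)
  have inv: "inv_image_iter D T n B = (S ^^ n) -` B \<inter> iter_dom D T n" for n B
    using fp by (auto simp: inv_image_iter_def)
  \<comment> \<open>At \<open>n = 0\<close> the domain is the whole type, so positivity of
    \<open>n\<close> matters here.\<close>
  have dom_sub: "iter_dom D T n \<subseteq> space M" if "n > 0" for n
    using that D(1) by (fastforce simp: iter_dom_def)
  have dom: "iter_dom D T n \<inter> space M \<in> sets M" for n
  proof -
    have "space M \<inter> (S ^^ k) -` D \<in> sets M" for k
      using Ds by (intro measure_preserving_map_funpow_sets[OF mp]) auto
    then have "{x \<in> space M. \<forall>k\<in>{..<n}. (S ^^ k) x \<in> D} \<in> sets M"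
      by (intro sets.sets_Collect_finite_All) (auto simp: vimage_def Int_def)
    also have "{x \<in> space M. \<forall>k\<in>{..<n}. (S ^^ k) x \<in> D} = iter_dom D T n \<inter> space M"
      by (auto simp: iter_dom)
    finally show ?thesis .
  qed
  have inv_sets: "inv_image_iter D T n B \<in> sets M" if "n > 0" "B \<in> sets M" for n B
  proof -
    have "inv_image_iter D T n B = (iter_dom D T n \<inter> space M) \<inter> (S ^^ n) -` B"
      unfolding inv using dom_sub[OF that(1)] by auto
    then show ?thesis
      using measure_preserving_map_funpow_sets[OF mp dom that(2)] by simp
  qed
  have null_conull: "measure M A = 0 \<or> measure M A = 1"
    if A: "A \<in> sets M" and tail: "\<And>n. n > 0 \<Longrightarrow> A \<in> pullback_algebra M D T n" for A
  proof (rule ccontr)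
    assume "\<not> ?thesis"
    then have pos: "c * measure M A * (1 - measure M A) > 0"
      using c prob_le_1[of A] measure_nonneg[of M A] by (intro mult_pos_pos) (auto simp: less_le)
    \<comment> \<open>Half of the main term that appears when the complement of \<open>B\<close> has
      measure \<open>1 - measure M A\<close>; the remaining half is a positive lower bound for the
      measure of a null intersection.\<close>
    define \<epsilon> where "\<epsilon> = c * measure M A * (1 - measure M A) / 2"
    have \<epsilon>: "\<epsilon> > 0" "c * measure M A * (1 - measure M A) = 2 * \<epsilon>"
      using pos by (auto simp: \<epsilon>_def)
    obtain N where N: "\<And>n B. n \<ge> N \<Longrightarrow> B \<in> sets M \<Longrightarrow>
        c * measure M A * measure M B - \<epsilon> \<le> measure M (A \<inter> (S ^^ n) -` B)"
      using sp A \<epsilon>(1) unfolding spreads_def by (metis spreads_atD)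
    \<comment> \<open>The successor makes \<open>n\<close> positive as well as at least
      \<open>N\<close>, as the tail condition concerns positive times only.\<close>
    define n where "n = Suc N"
    obtain B where B: "B \<in> sets M" "sym_diff A (inv_image_iter D T n B) \<in> null_sets M"
      using tail[of n] by (auto simp: pullback_algebra_def n_def)
    have AE: "AE x in M. x \<in> A \<longleftrightarrow> (S ^^ n) x \<in> B"
      using AE_not_in[OF B(2)] AE_dom[of n] by eventually_elim (auto simp: inv)
    \<comment> \<open>Up to a null set \<open>A\<close> is the preimage of \<open>B\<close>, so
      \<open>B\<close> has the measure of \<open>A\<close>, and the preimage of the complement of
      \<open>B\<close> misses \<open>A\<close> almost everywhere.\<close>
    have "measure M A = measure M ((S ^^ n) -` B \<inter> space M)"
      using AE A B(1) measurable_sets[OF measure_preserving_map_funpow[OF mp] B(1)]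
      by (intro finite_measure_eq_AE) (auto elim: AE_mp)
    then have "measure M (space M - B) = 1 - measure M A"
      using B(1) by (simp add: measure_vimage_funpow[OF mp] prob_compl)
    moreover have "measure M (A \<inter> (S ^^ n) -` (space M - B)) = measure M {}"
      using AE A B(1) measure_preserving_map_funpow_sets[OF mp A, of "space M - B" n]
      by (intro finite_measure_eq_AE) (auto elim: AE_mp)
    ultimately show False
      using N[of n "space M - B"] B(1) \<epsilon> by (simp add: n_def)
  qed
  have "(\<Inter>n\<in>{0<..}. pullback_algebra M D T n) = null_conull_algebra M"
  proof (intro equalityI subsetI)
    fix A assume "A \<in> (\<Inter>n\<in>{0<..}. pullback_algebra M D T n)"
    then have tail: "A \<in> pullback_algebra M D T n" if "n > 0" for n
      using that by auto
    from tail[of 1] have A: "A \<in> sets M" by (simp add: pullback_algebra_def)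
    from null_conull[OF A tail] have "measure M A = 0 \<or> measure M (space M - A) = 0"
      using A by (auto simp: prob_compl)
    then show "A \<in> null_conull_algebra M"
      using A by (auto simp: null_conull_algebra_def emeasure_eq_measure intro!: null_setsI)
  next
    fix A assume "A \<in> null_conull_algebra M"
    then have A: "A \<in> sets M" and nc: "A \<in> null_sets M \<or> space M - A \<in> null_sets M"
      by (auto simp: null_conull_algebra_def)
    have "A \<in> pullback_algebra M D T n" if n: "n > 0" for n
    proof -
      \<comment> \<open>Witnesses are the empty set for a null \<open>A\<close> and the whole space
        for a conull \<open>A\<close>; the preimage of the latter is the domain of the iterate,
        which is conull.\<close>
      consider "A \<in> null_sets M" | "space M - A \<in> null_sets M" using nc by blast
      then have "\<exists>B\<in>sets M. sym_diff A (inv_image_iter D T n B) \<in> null_sets M"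
      proof cases
        case 1
        then show ?thesis by (intro bexI[of _ "{}"]) (auto simp: inv)
      next
        case 2
        have "AE x in M. x \<notin> sym_diff A (inv_image_iter D T n (space M))"
          using AE_dom[of n] AE_not_in[OF 2] AE_space
          by eventually_elim
            (use measurable_space[OF measure_preserving_map_funpow[OF mp]] in \<open>auto simp: inv\<close>)
        then have "sym_diff A (inv_image_iter D T n (space M)) \<in> null_sets M"
          using A inv_sets[OF n, of "space M"] by (subst AE_iff_null_sets) auto
        then show ?thesis by blast
      qed
      then show ?thesis using A by (simp add: pullback_algebra_def)
    qed
    then show "A \<in> (\<Inter>n\<in>{0<..}. pullback_algebra M D T n)" by auto
  qed
  moreover have "(\<lambda>n. measure M (fwd_image D T n A)) \<longlonglongrightarrow> 1"
    if A: "A \<in> sets M" "measure M A > 0" and fwd: "\<And>n. fwd_image D T n A \<in> sets M" for A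
  proof (rule LIMSEQ_I)
    fix r :: real assume r: "r > 0"
    define \<epsilon> where "\<epsilon> = c * measure M A * r / 2"
    have \<epsilon>: "\<epsilon> > 0" using c A r by (simp add: \<epsilon>_def)
    obtain N where N: "\<And>n B. n \<ge> N \<Longrightarrow> B \<in> sets M \<Longrightarrow>
        c * measure M A * measure M B - \<epsilon> \<le> measure M (A \<inter> (S ^^ n) -` B)"
      using sp A(1) \<epsilon> unfolding spreads_def by (metis spreads_atD)
    show "\<exists>N. \<forall>n\<ge>N. norm (measure M (fwd_image D T n A) - 1) < r"
    proof (intro exI[of _ N] allI impI)
      fix n assume n: "n \<ge> N"
      \<comment> \<open>This test set changes with \<open>n\<close>, which the uniform threshold
        \<open>N\<close> permits. Points of \<open>A\<close> can reach it at time \<open>n\<close>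
        only from outside the domain of the iterate, hence from a null set.\<close>
      define B where "B = space M - fwd_image D T n A"
      have B: "B \<in> sets M" using fwd by (simp add: B_def)
      have "AE x in M. x \<notin> A \<inter> (S ^^ n) -` B"
        using AE_dom[of n] by eventually_elim (auto simp: B_def fwd_image_def fp)
      then have "measure M (A \<inter> (S ^^ n) -` B) = measure M {}"
        using measure_preserving_map_funpow_sets[OF mp A(1) B]
        by (intro finite_measure_eq_AE) (auto elim: AE_mp)
      then have "c * measure M A * measure M B \<le> c * measure M A * (r / 2)"
        using N[OF n B] by (simp add: \<epsilon>_def)
      then have "measure M B \<le> r / 2"
        using c A(2) by (simp add: mult_le_cancel_left_pos)
      moreover have "measure M B = 1 - measure M (fwd_image D T n A)"
        using fwd by (simp add: B_def prob_compl)
      ultimately show "norm (measure M (fwd_image D T n A) - 1) < r"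
        using r prob_le_1[of "fwd_image D T n A"] by simp
    qed
  qed
  ultimately show ?thesis
    using ds unfolding exact_system_def by blast
qed

section \<open>Bounded distortion implies spreading\<close>

lemma spreads_if_bounded_distortion:
  assumes "prob_space M" and mp: "measure_preserving_map M S"
    and eq: "\<And>x. x \<in> D \<Longrightarrow> S x = T x"
    and A_sets: "\<A> \<subseteq> sets M"
    and approx: "\<And>B \<epsilon>. B \<in> sets M \<Longrightarrow> \<epsilon> > 0 \<Longrightarrow>
          \<exists>\<C>. \<C> \<subseteq> \<A> \<and> countable \<C> \<and> disjoint \<C> \<and> measure M (sym_diff B (\<Union>\<C>)) < \<epsilon>"
    and image_sets: "\<And>A B. A \<in> \<A> \<Longrightarrow> B \<in> sets M \<Longrightarrow> B \<subseteq> A \<Longrightarrow> fwd_image D T (n A) B \<in> sets M"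
    and full: "\<And>A. A \<in> \<A> \<Longrightarrow> measure M (fwd_image D T (n A) A) = 1"
    and l: "l > 0"
    and distortion: "\<And>A B. A \<in> \<A> \<Longrightarrow> measure M A > 0 \<Longrightarrow> B \<in> sets M \<Longrightarrow> B \<subseteq> A \<Longrightarrow>
          measure M (fwd_image D T (n A) B) \<le> l * (measure M B / measure M A)"
  shows "spreads (1 / l) M S"
proof -
  interpret prob_space M by fact
  have fp: "(S ^^ k) x = (T ^^ k) x" if "x \<in> iter_dom D T k" for x k
    using eq that by (rule funpow_eq_on_iter_dom)
  have "spreads_at (1 / l) M S A" if A: "A \<in> \<A>" for A
  \<comment> \<open>The distortion bound is available only where its denominator is positive; a null
    set spreads trivially.\<close>
  proof (cases "measure M A = 0")
    case False
    then have pos: "measure M A > 0" by (simp add: less_le)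
    have As: "A \<in> sets M" using A A_sets by auto
    have "1 / l * measure M A * measure M B \<le> measure M (A \<inter> (S ^^ k) -` B)"
      if k: "k \<ge> n A" and B: "B \<in> sets M" for k B
    proof -
      \<comment> \<open>The time \<open>k\<close> is split: the first \<open>n A\<close> steps are
        governed by distortion, and the remaining ones only replace \<open>B\<close> by a set of
        equal measure.\<close>
      define B' where "B' = (S ^^ (k - n A)) -` B \<inter> space M"
      have B': "B' \<in> sets M"
        unfolding B'_def by (rule measurable_sets[OF measure_preserving_map_funpow[OF mp] B])
      define C where "C = A \<inter> (S ^^ n A) -` B'"
      have C: "C \<in> sets M" "C \<subseteq> A"
        unfolding C_def using measure_preserving_map_funpow_sets[OF mp As B'] by auto
      have "(S ^^ (k - n A)) ((S ^^ n A) x) = (S ^^ k) x" for x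
        using k by (metis comp_apply funpow_add le_add_diff_inverse2)
      then have C_eq: "C = A \<inter> (S ^^ k) -` B"
        using measurable_space[OF measure_preserving_map_funpow[OF mp, of "n A"]]
          sets.sets_into_space[OF As] by (auto simp: C_def B'_def)
      have F: "fwd_image D T (n A) A \<in> sets M" "fwd_image D T (n A) C \<in> sets M"
        using image_sets[OF A] As C by auto
      have "measure M B = measure M B'"
        unfolding B'_def by (rule measure_vimage_funpow[OF mp B, symmetric])
      also have "\<dots> = measure M (fwd_image D T (n A) A \<inter> B')"
        using measure_space_inter[OF B' F(1)] full[OF A] by (simp add: prob_space Int_commute)
      also have "\<dots> \<le> measure M (fwd_image D T (n A) C)"
      proof (rule finite_measure_mono[OF _ F(2)])
        \<comment> \<open>A point of \<open>B'\<close> that is the image of some point of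
          \<open>A\<close> is the image of a point of \<open>C\<close>, by the definition of
          \<open>C\<close>. As almost every point is an image of a point of \<open>A\<close>, the
          image of \<open>C\<close> has at least the measure of \<open>B'\<close>.\<close>
        show "fwd_image D T (n A) A \<inter> B' \<subseteq> fwd_image D T (n A) C"
          using fp[of _ "n A"] by (auto simp: fwd_image_def C_def)
      qed
      also have "\<dots> \<le> l * (measure M C / measure M A)"
        by (rule distortion[OF A pos C])
      finally show ?thesis
        using l pos unfolding C_eq[symmetric] by (simp add: field_simps)
    qed
    then show ?thesis
      unfolding spreads_at_def by (intro allI impI exI[of _ "n A"] ballI) (smt (verit, best))
  qed (rule spreads_at_measure_0)
  then show ?thesis
    using l A_sets by (intro spreads_if_approximable[OF mp _ _ _ approx]) auto
qed

section \<open>Exactness of the product system\<close>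

theorem theorem1:
  fixes d :: nat
    and M :: "nat \<Rightarrow> 'a measure"
    and D :: "nat \<Rightarrow> 'a set"
    and T :: "nat \<Rightarrow> 'a \<Rightarrow> 'a"
    and \<A> :: "nat \<Rightarrow> 'a set set"
    and n :: "nat \<Rightarrow> 'a set \<Rightarrow> nat"
    and lam :: "nat \<Rightarrow> real"
  assumes d: "d \<ge> 1"
    and sys: "\<And>i. i \<in> {1..d} \<Longrightarrow> dynamical_system (M i) (D i) (T i)"
    and A_sets: "\<And>i. i \<in> {1..d} \<Longrightarrow> \<A> i \<subseteq> sets (M i)"
    and approx: "\<And>i B \<epsilon>. i \<in> {1..d} \<Longrightarrow> B \<in> sets (M i) \<Longrightarrow> \<epsilon> > 0 \<Longrightarrow>
          \<exists>\<C>. \<C> \<subseteq> \<A> i \<and> countable \<C> \<and> disjoint \<C> \<and>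
              measure (M i) (sym_diff B (\<Union>\<C>)) < \<epsilon>"
    and image_sets: "\<And>i A B. i \<in> {1..d} \<Longrightarrow> A \<in> \<A> i \<Longrightarrow> B \<in> sets (M i) \<Longrightarrow> B \<subseteq> A \<Longrightarrow>
          fwd_image (D i) (T i) (n i A) B \<in> sets (M i)"
    and full: "\<And>i A. i \<in> {1..d} \<Longrightarrow> A \<in> \<A> i \<Longrightarrow>
          measure (M i) (fwd_image (D i) (T i) (n i A) A) = 1"
    and lam_pos: "\<And>i. i \<in> {1..d} \<Longrightarrow> lam i > 0"
    and distortion: "\<And>i A B. i \<in> {1..d} \<Longrightarrow> A \<in> \<A> i \<Longrightarrow> measure (M i) A > 0 \<Longrightarrow>
          B \<in> sets (M i) \<Longrightarrow> B \<subseteq> A \<Longrightarrow>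
          measure (M i) (fwd_image (D i) (T i) (n i A) B)
            \<le> lam i * (measure (M i) B / measure (M i) A)"
  shows "exact_system (PiM {1..d} M) (PiE {1..d} D) (prod_map {1..d} T)"
proof -
  let ?I = "{1..d}"
  have prob: "prob_space (M i)" if "i \<in> ?I" for i
    using sys[OF that] by (simp add: dynamical_system_def)
  have D: "D i \<subseteq> space (M i)" "space (M i) - D i \<in> null_sets (M i)" if "i \<in> ?I" for i
    using sys[OF that] by (auto simp: dynamical_system_def)
  have "\<exists>S. measure_preserving_map (M i) S \<and> (\<forall>x\<in>D i. S x = T i x)" if "i \<in> ?I" for i
    using dynamical_system_totalize[OF sys[OF that]] by metis
  then obtain S where mp: "\<And>i. i \<in> ?I \<Longrightarrow> measure_preserving_map (M i) (S i)"
    and eq: "\<And>i x. i \<in> ?I \<Longrightarrow> x \<in> D i \<Longrightarrow> S i x = T i x"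
    by metis
  have sp: "spreads (1 / lam i) (M i) (S i)" if i: "i \<in> ?I" for i
    by (rule spreads_if_bounded_distortion[where D = "D i" and T = "T i" and \<A> = "\<A> i" and n = "n i"])
      (use prob mp eq A_sets approx image_sets full lam_pos distortion i in auto)
  have *: "measure_preserving_map (PiM ?I M) (prod_map ?I S)"
    "spreads (\<Prod>i\<in>?I. 1 / lam i) (PiM ?I M) (prod_map ?I S)"
    using measure_preserving_spreads_PiM[of ?I M S "\<lambda>i. 1 / lam i"] prob mp sp lam_pos
    by (auto simp: less_imp_le)
  have P: "prob_space (PiM ?I M)" using prob by (rule prob_space_PiM)
  have sub: "PiE ?I D \<subseteq> space (PiM ?I M)"
    using D(1) by (auto simp: space_PiM PiE_def Pi_def subset_iff)
  have "D i \<in> sets (M i)" if "i \<in> ?I" for i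
    using D[OF that] by (metis double_diff null_setsD2 order_refl sets.compl_sets)
  then have Ds: "PiE ?I D \<in> sets (PiM ?I M)" by (intro sets_PiM_I_finite) auto
  \<comment> \<open>The box of the domains is conull because each of its finitely many coordinate
    conditions holds almost everywhere.\<close>
  have "AE x in PiM ?I M. x i \<in> D i" if i: "i \<in> ?I" for i
  proof (rule AE_PiM_component[OF prob i])
    show "AE x in M i. x \<in> D i"
      using AE_not_in[OF D(2)[OF i]] by (auto elim: AE_mp)
  qed
  then have "AE x in PiM ?I M. \<forall>i\<in>?I. x i \<in> D i" by (intro AE_finite_allI) auto
  then have "AE x in PiM ?I M. x \<notin> space (PiM ?I M) - PiE ?I D"
    by eventually_elim (auto simp: space_PiM PiE_def)
  then have null: "space (PiM ?I M) - PiE ?I D \<in> null_sets (PiM ?I M)"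
    using Ds by (subst AE_iff_null_sets) auto
  show ?thesis
  proof (rule exact_system_if_spreads[OF P *(1) sub null _ _ *(2)])
    show "prod_map ?I S x = prod_map ?I T x" if "x \<in> PiE ?I D" for x
      unfolding prod_map_def using eq PiE_mem[OF that] by (intro restrict_ext) auto
    show "0 < (\<Prod>i\<in>?I. 1 / lam i)" using lam_pos by (intro prod_pos) auto
  qed
qed

end
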